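(* Let $\kappa$ be a singular strong limit cardinal of uncountable cofinality. Then the following statements are equivalent: (A) There is a $T_1$-topology $\tau$ without isolated points on $\kappa$ such that, with $J$ denoting the ideal of nowhere dense subsets of $(\kappa,\tau)$, player TWO does not have a winning coding strategy in the game $\mathrm{RG}(J)$. (B) There are infinitely many cardinal numbers between $\kappa$ and $2^{\kappa}$.
   Context: Let $(X,\tau)$ be a $T_1$ topological space without isolated points, let $J$ be the ideal of nowhere dense subsets of $X$, and let $\langle J\rangle$ be the collection of meager subsets of $X$ (countable unions of nowhere dense sets). The game $\mathrm{RG}(J)$: players ONE and TWO play one inning for each positive integer $k$. In inning $k$, ONE first chooses a meager set $M_k\in\langle J\rangle$ (with no further constraints on ONE's moves), and then TWO responds with a nowhere dense set $N_k\in J$. TWO wins the play $(M_1,N_1,M_2,N_2,\ldots)$ if $\bigcup_{k=1}^{\infty}M_k\subseteq\bigcup_{k=1}^{\infty}N_k$; otherwise ONE wins. A coding strategy for TWO is a function $F$ with values in $J$, defined on $\langle J\rangle\cup(J\times\langle J\rangle)$, according to which TWO plays $N_1=F(M_1)$ and $N_{k+1}=F(N_k,M_{k+1})$ for all $k\ge 1$. It is a winning coding strategy if TWO wins every play in which TWO's moves are determined by $F$ in this way, i.e. for every sequence $(M_k)_{k\ge1}$ of meager sets, the sets $N_k$ so defined satisfy $\bigcup_{k}M_k\subseteq\bigcup_{k}N_k$. The underlying set theory is ZFC. *)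

theory Defs
  imports "HOL-Analysis.Analysis"
begin

unbundle cardinal_syntax

text \<open>
  Cardinals are cardinal orders in the sense of \<^const>\<open>Card_order\<close>: well-orders \<open>r\<close> that are
  minimal among the well-orders of \<^term>\<open>Field r\<close>. The points of the cardinal \<open>r\<close> are the
  elements of \<^term>\<open>Field r\<close>.
\<close>

definition singularCard :: "'a rel \<Rightarrow> bool" where
  "singularCard r \<longleftrightarrow> Cinfinite r \<and> \<not> regularCard r"

text \<open>
  Every cardinal below \<open>r\<close> is represented by a cardinal order on the type underlying \<open>r\<close>,
  so quantifying over that type in \<open>strong_limit\<close> loses nothing.
\<close>

definition strong_limit :: "'a rel \<Rightarrow> bool" where
  "strong_limit r \<longleftrightarrow> Cinfinite r \<and>
     (\<forall>s :: 'a rel. Card_order s \<and> s <o r \<longrightarrow> ctwo ^c s <o r)"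

text \<open>
  The cofinality is chosen as a cardinal order, hence determined only up to \<^const>\<open>ordIso\<close>.
\<close>

definition cofinality :: "'a rel \<Rightarrow> 'a rel" where
  "cofinality r = (SOME c.
     (\<exists>K\<subseteq>Field r. cofinal K r \<and> c = |K| ) \<and>
     (\<forall>K\<subseteq>Field r. cofinal K r \<longrightarrow> c \<le>o |K| ))"

lemma cofinality_props:
  assumes "Cinfinite r"
  shows "\<exists>K\<subseteq>Field r. cofinal K r \<and> cofinality r = |K|"
    and "\<And>K. K \<subseteq> Field r \<Longrightarrow> cofinal K r \<Longrightarrow> cofinality r \<le>o |K|"
proof -
  let ?R = "{|K| | K. K \<subseteq> Field r \<and> cofinal K r}"
  have "cofinal (Field r) r"
    using assms infinite_Card_order_limit[of r]
    unfolding cofinal_def cinfinite_def by (meson FieldI2)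
  then have "?R \<noteq> {}" by blast
  moreover have "\<forall>c\<in>?R. Card_order c" using card_of_Card_order by blast
  ultimately obtain c where "c \<in> ?R" "\<forall>c'\<in>?R. c \<le>o c'"
    using exists_minim_Card_order[of ?R] by blast
  then have "(\<exists>K\<subseteq>Field r. cofinal K r \<and> c = |K| ) \<and>
      (\<forall>K\<subseteq>Field r. cofinal K r \<longrightarrow> c \<le>o |K| )"
    by blast
  then have *: "(\<exists>K\<subseteq>Field r. cofinal K r \<and> cofinality r = |K| ) \<and>
      (\<forall>K\<subseteq>Field r. cofinal K r \<longrightarrow> cofinality r \<le>o |K| )"
    unfolding cofinality_def by (rule someI)
  show "\<exists>K\<subseteq>Field r. cofinal K r \<and> cofinality r = |K|" using * by blast
  show "\<And>K. K \<subseteq> Field r \<Longrightarrow> cofinal K r \<Longrightarrow> cofinality r \<le>o |K|" using * by blast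
qed

lemma singularCard_iff_cofinality:
  "singularCard r \<longleftrightarrow> Cinfinite r \<and> cofinality r <o r"
proof (cases "Cinfinite r")
  case True
  have le: "|K| \<le>o r" if "K \<subseteq> Field r" for K
    using that True card_of_Field_ordIso card_of_mono1 ordLeq_ordIso_trans by blast
  have "\<not> regularCard r \<longleftrightarrow> cofinality r <o r"
  proof
    assume "\<not> regularCard r"
    then obtain K where K: "K \<subseteq> Field r" "cofinal K r" "\<not> |K| =o r"
      unfolding regularCard_def by blast
    then have "|K| <o r" using le ordLeq_iff_ordLess_or_ordIso by blast
    then show "cofinality r <o r"
      using cofinality_props(2)[OF True K(1,2)] ordLeq_ordLess_trans by blast
  next
    assume lt: "cofinality r <o r"
    obtain K where K: "K \<subseteq> Field r" "cofinal K r" "cofinality r = |K|"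
      using cofinality_props(1)[OF True] by blast
    then show "\<not> regularCard r"
      using lt not_ordLess_ordIso unfolding regularCard_def by metis
  qed
  then show ?thesis using True by (simp add: singularCard_def)
qed (auto simp: singularCard_def)

text \<open>
  Cardinal numbers are the classes of cardinal orders modulo \<^const>\<open>ordIso\<close>. Since the bound
  \<open>t\<close> has its field in \<open>'b\<close>, every cardinal below \<open>t\<close> has a representative on \<open>'b\<close>.
\<close>

definition cardinals_between :: "'a rel \<Rightarrow> 'b rel \<Rightarrow> 'b rel set set" where
  "cardinals_between r t = {s :: 'b rel. Card_order s \<and> r <o s \<and> s <o t} // ordIso"


definition no_isolated_points :: "'a topology \<Rightarrow> bool" where
  "no_isolated_points X \<longleftrightarrow> (\<forall>x\<in>topspace X. \<not> openin X {x})"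

definition nowhere_dense_sets :: "'a topology \<Rightarrow> 'a set set" where
  "nowhere_dense_sets X = {S. S \<subseteq> topspace X \<and> X interior_of (X closure_of S) = {}}"

definition countable_unions :: "'a set set \<Rightarrow> 'a set set" where
  "countable_unions J = {\<Union>\<C> | \<C>. countable \<C> \<and> \<C> \<subseteq> J}"


text \<open>
  Innings are numbered from \<open>0\<close>. A coding strategy is a function on the disjoint union
  of the possible first moves of ONE (tagged \<^const>\<open>Inl\<close>) and the pairs consisting of TWO's
  previous move and ONE's current move (tagged \<^const>\<open>Inr\<close>); only its values on
  \<open>coding_domain J\<close> matter.
\<close>

definition coding_domain :: "'a set set \<Rightarrow> ('a set + 'a set \<times> 'a set) set" where
  "coding_domain J = countable_unions J <+> (J \<times> countable_unions J)"

definition coding_strategy ::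
    "'a set set \<Rightarrow> ('a set + 'a set \<times> 'a set \<Rightarrow> 'a set) \<Rightarrow> bool" where
  "coding_strategy J F \<longleftrightarrow> F \<in> coding_domain J \<rightarrow> J"

primrec coding_play ::
    "('a set + 'a set \<times> 'a set \<Rightarrow> 'a set) \<Rightarrow> (nat \<Rightarrow> 'a set) \<Rightarrow> nat \<Rightarrow> 'a set" where
  "coding_play F M 0 = F (Inl (M 0))"
| "coding_play F M (Suc k) = F (Inr (coding_play F M k, M (Suc k)))"

definition TWO_wins_play :: "(nat \<Rightarrow> 'a set) \<Rightarrow> (nat \<Rightarrow> 'a set) \<Rightarrow> bool" where
  "TWO_wins_play M N \<longleftrightarrow> (\<Union>k. M k) \<subseteq> (\<Union>k. N k)"

definition winning_coding_strategy ::
    "'a set set \<Rightarrow> ('a set + 'a set \<times> 'a set \<Rightarrow> 'a set) \<Rightarrow> bool" where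
  "winning_coding_strategy J F \<longleftrightarrow> coding_strategy J F \<and>
     (\<forall>M. (\<forall>k. M k \<in> countable_unions J) \<longrightarrow> TWO_wins_play M (coding_play F M))"

end

(*
  Both statements are equivalent to the existence of a cardinal \<mu> with \<kappa> \<le> \<mu> \<le> 2^\<kappa> and
  \<mu>^\<omega> > \<mu>. Since \<kappa>^\<omega> = \<kappa>, and \<nu>^\<omega> = \<nu> passes from \<nu> to its successor, such a \<mu> has infinitely
  many cardinals between \<kappa> and itself; conversely, by Koenig's theorem the supremum of a strictly
  increasing \<omega>-sequence of cardinals is such a \<mu>.

  If the ideal J of nowhere dense sets satisfies |J|^\<omega> = |J|, then there are only |J| finite
  histories of the game, and TWO can choose nowhere dense sets that cover the required pieces of
  ONE's moves and at the same time determine the whole history.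

  Conversely, given \<mu>, take a family \<S> of \<mu> subsets S of \<kappa> and a cofinal K \<subseteq> \<kappa> of size below \<kappa>.
  The branches A_S = {(\<alpha>, S \<inter> \<alpha>). \<alpha> \<in> K} are almost disjoint, and they generate together with the
  finite sets an ideal J of size \<mu>; the sets of J are the proper closed sets of a topology whose
  nowhere dense sets are exactly J. Let ONE play unions of countably many branches. There are more
  than \<mu> such unions, so for every N some answer N' of TWO to (N, M) occurs for more than \<mu> of
  them. Iterating this fixes in advance all of TWO's moves N_k, whereas their union contains at most
  2^\<omega> \<le> \<mu> of the available moves of ONE.
*)

theory Submission
  imports Defs
begin

section \<open>Cardinal arithmetic\<close>

lemma ordLeq_total_card_of: "|A| \<le>o |B| \<or> |B| <o |A|"
  using ordLess_or_ordLeq[OF card_of_Well_order card_of_Well_order] by blast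

text \<open>If \<open>A <+> B\<close> is infinite, it already dominates the product of its summands,
  which reduces the claim to sums; otherwise the product is finite.\<close>

lemma card_of_Times_ordLess_infinite:
  assumes "infinite C" "|A| <o |C|" "|B| <o |C|"
  shows "|A \<times> B| <o |C|"
proof (cases "finite (A <+> B)")
  case True
  then have "finite (A \<times> B)" by simp
  then show ?thesis
    using assms(1) ordLeq_total_card_of card_of_ordLeq_finite by blast
next
  case False
  have "|A \<times> B| \<le>o |A <+> B|"
    by (rule card_of_Sigma_ordLeq_infinite[OF False])
      (auto intro: card_of_Plus1 card_of_Plus2)
  also have "|A <+> B| <o |C|"
    using assms by (rule card_of_Plus_ordLess_infinite)
  finally show ?thesis .
qed

text \<open>Transfinite recursion along the well-order \<open>|H|\<close>: the strict predecessors
  of \<open>h\<close> are fewer than \<open>|H|\<close>, so the values chosen earlier cannot exhaust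
  \<open>S h\<close>. This will give distinct histories of the game distinct codes.\<close>

lemma inj_on_selection:
  assumes large: "\<And>h. h \<in> H \<Longrightarrow> |H| \<le>o |S h|"
  shows "\<exists>G. inj_on G H \<and> (\<forall>h\<in>H. G h \<in> S h)"
proof -
  let ?r = "|H|"
  have wo: "wo_rel ?r" using card_of_Well_order by (simp add: wo_rel_def)
  have wf: "wf (?r - Id)"
    using card_of_well_order_on[of H] by (simp add: well_order_on_def)
  define G where "G = wfrec (?r - Id) (\<lambda>G h. SOME y. y \<in> S h \<and> y \<notin> G ` underS ?r h)"
  have eq: "G h = (SOME y. y \<in> S h \<and> y \<notin> G ` underS ?r h)" for h
  proof -
    have "cut G (?r - Id) h ` underS ?r h = G ` underS ?r h"
      by (auto simp: cut_def underS_def image_iff)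
    then show ?thesis
      unfolding G_def by (subst wfrec[OF wf]) (simp add: G_def)
  qed
  have G: "G h \<in> S h \<and> G h \<notin> G ` underS ?r h" if "h \<in> H" for h
  proof -
    have "|G ` underS ?r h| <o |S h|"
      using card_of_underS[OF card_of_Card_order, of h H] that large[OF that] card_of_image
      by (metis Field_card_of ordLeq_ordLess_trans ordLess_ordLeq_trans)
    then have "\<not> S h \<subseteq> G ` underS ?r h"
      using card_of_mono1 not_ordLess_ordLeq by blast
    then have "\<exists>y. y \<in> S h \<and> y \<notin> G ` underS ?r h" by blast
    then show ?thesis unfolding eq[of h] by (rule someI_ex)
  qed
  have "inj_on G H"
  proof (rule inj_onI, rule ccontr)
    fix x y assume xy: "x \<in> H" "y \<in> H" "G x = G y" "x \<noteq> y"
    then have "x \<in> underS ?r y \<or> y \<in> underS ?r x"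
      using wo_rel.TOTALS[OF wo] by (auto simp: underS_def Field_card_of)
    then show False using G xy by (metis imageI)
  qed
  with G show ?thesis by blast
qed

lemma card_of_lists_infinite:
  assumes "infinite A"
  shows "|lists A| \<le>o |A|"
proof -
  have len: "|{xs \<in> lists A. length xs = n}| \<le>o |A|" for n
  proof (induction n)
    case 0
    have "{xs \<in> lists A. length xs = 0} = {[]}" by auto
    then show ?case
      using assms by (metis card_of_singl_ordLeq finite.emptyI)
  next
    case (Suc n)
    let ?L = "{xs \<in> lists A. length xs = n}"
    have "{xs \<in> lists A. length xs = Suc n} \<subseteq> (\<lambda>(x, xs). x # xs) ` (A \<times> ?L)"
      by (auto simp: length_Suc_conv image_iff)
    then have "|{xs \<in> lists A. length xs = Suc n}| \<le>o |A \<times> ?L|"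
      by (meson card_of_image card_of_mono1 ordLeq_transitive)
    also have "|A \<times> ?L| \<le>o |A|"
      by (rule card_of_Sigma_ordLeq_infinite[OF assms]) (use Suc card_of_mono1 in auto)
    finally show ?case .
  qed
  have "lists A = (\<Union>n. {xs \<in> lists A. length xs = n})" by auto
  moreover have "|\<Union>n. {xs \<in> lists A. length xs = n}| \<le>o |A|"
    using len infinite_iff_card_of_nat[THEN iffD1, OF assms]
    by (intro card_of_UNION_ordLeq_infinite[OF assms]) auto
  ultimately show ?thesis by simp
qed

lemma card_of_Fpow_infinite:
  assumes "infinite A"
  shows "|Fpow A| \<le>o |A|"
proof -
  have "Fpow A \<subseteq> set ` lists A"
    by (auto simp: Fpow_def image_iff) (metis finite_list lists_eq_set mem_Collect_eq)
  then show ?thesis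
    by (meson card_of_image card_of_lists_infinite assms card_of_mono1 ordLeq_transitive)
qed

text \<open>These are the \<omega>-sequences in \<open>A\<close>, so \<open>|seqs A|\<close> plays
  the role of the countable power of \<open>|A|\<close>.\<close>

definition seqs :: "'a set \<Rightarrow> (nat \<Rightarrow> 'a) set" where
  "seqs A = {f. \<forall>n. f n \<in> A}"

lemma card_of_seqs_mono:
  assumes "|A| \<le>o |B|"
  shows "|seqs A| \<le>o |seqs B|"
proof -
  obtain g where g: "inj_on g A" "g ` A \<subseteq> B"
    using card_of_ordLeq[THEN iffD2, OF assms] by blast
  have "inj_on (\<lambda>f. g \<circ> f) (seqs A)"
  proof (rule inj_onI)
    fix f f' assume f: "f \<in> seqs A" "f' \<in> seqs A" "g \<circ> f = g \<circ> f'"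
    have "f n = f' n" for n
    proof (rule inj_onD[OF g(1)])
      show "g (f n) = g (f' n)" using fun_cong[OF f(3), of n] by simp
    qed (use f in \<open>auto simp: seqs_def\<close>)
    then show "f = f'" by blast
  qed
  moreover have "(\<lambda>f. g \<circ> f) ` seqs A \<subseteq> seqs B"
    using g(2) by (auto simp: seqs_def)
  ultimately show ?thesis using card_of_ordLeq by blast
qed

section \<open>Coding strategies\<close>

definition set_ideal :: "'a set set \<Rightarrow> bool" where
  "set_ideal J \<longleftrightarrow> {} \<in> J \<and> (\<forall>A\<in>J. \<forall>B. B \<subseteq> A \<longrightarrow> B \<in> J) \<and> (\<forall>A\<in>J. \<forall>B\<in>J. A \<union> B \<in> J)"

lemma set_ideal_subset: "set_ideal J \<Longrightarrow> A \<in> J \<Longrightarrow> B \<subseteq> A \<Longrightarrow> B \<in> J"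
  by (auto simp: set_ideal_def)

lemma set_ideal_Un: "set_ideal J \<Longrightarrow> A \<in> J \<Longrightarrow> B \<in> J \<Longrightarrow> A \<union> B \<in> J"
  by (auto simp: set_ideal_def)

lemma set_ideal_UN:
  assumes "set_ideal J" "finite I" "\<And>i. i \<in> I \<Longrightarrow> A i \<in> J"
  shows "(\<Union>i\<in>I. A i) \<in> J"
  using assms(2,3)
  by (induction I) (use assms(1) in \<open>auto simp: set_ideal_def\<close>)

lemma countable_unions_eq:
  assumes "{} \<in> J"
  shows "countable_unions J = {\<Union>n. p n | p :: nat \<Rightarrow> 'a set. range p \<subseteq> J}" (is "_ = ?R")
proof
  show "countable_unions J \<subseteq> ?R"
  proof
    fix M assume "M \<in> countable_unions J"
    then obtain \<C> where \<C>: "countable \<C>" "\<C> \<subseteq> J" "M = \<Union>\<C>"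
      by (auto simp: countable_unions_def)
    \<comment> \<open>Adding the empty set keeps the union and makes the family nonempty, so that
      its enumeration has exactly this range.\<close>
    let ?p = "from_nat_into (insert {} \<C>)"
    have "range ?p = insert {} \<C>"
      using \<C> by (intro range_from_nat_into) auto
    then have "M = (\<Union>n. ?p n)" "range ?p \<subseteq> J"
      using \<C> assms by auto
    then show "M \<in> ?R" by blast
  qed
  show "?R \<subseteq> countable_unions J"
  proof
    fix M assume "M \<in> ?R"
    then obtain p :: "nat \<Rightarrow> 'a set" where "range p \<subseteq> J" "M = \<Union>(range p)" by blast
    then show "M \<in> countable_unions J"
      unfolding countable_unions_def by (metis (mono_tags, lifting) countableI_type
          countable_image mem_Collect_eq)
  qed
qed

lemma card_of_countable_unions:
  assumes "{} \<in> J"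
  shows "|countable_unions J| \<le>o |seqs J|"
proof -
  have "countable_unions J = (\<lambda>p. \<Union>n. p n) ` seqs J"
    by (auto simp: countable_unions_eq[OF assms] seqs_def image_subset_iff)
  then show ?thesis by (simp add: card_of_image)
qed

text \<open>
  If some \<open>A \<in> J\<close> has at least \<open>|J|\<close> subsets, then the two halves of \<open>A\<close> take turns carrying
  information; otherwise every member of \<open>J\<close> has \<open>|J|\<close> supersets in \<open>J\<close> already.
\<close>

lemma many_supersets_up_to_half:
  assumes J: "set_ideal J" and inf: "infinite J"
  obtains E :: "bool \<Rightarrow> 'a set" where "E True \<inter> E False = {}"
    and "\<And>P b. P \<in> J \<Longrightarrow> |J| \<le>o |{N \<in> J. P - E b \<subseteq> N}|"
proof (cases "\<exists>A\<in>J. |J| \<le>o |Pow A|")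
  case True
  then obtain A where A: "A \<in> J" "|J| \<le>o |Pow A|" by blast
  have infA: "infinite A"
    using A(2) inf card_of_ordLeq_infinite by blast
  then obtain g where g: "bij_betw g (A <+> A) A"
    using card_of_Plus_infinite1[OF infA, of A] card_of_ordIso ordLeq_refl[OF card_of_Card_order]
    by (metis card_of_refl ordIso_imp_ordLeq)
  \<comment> \<open>\<open>g\<close> identifies two disjoint copies of \<open>A\<close> with
    \<open>A\<close>; their images are the two halves, each as large as \<open>A\<close>.\<close>
  define E where "E b = (if b then g ` (A <+> {}) else g ` ({} <+> A))" for b
  have E: "E b \<subseteq> A" for b
    using g by (auto simp: E_def bij_betw_def)
  have "E True \<inter> E False = {}"
    using g by (force simp: E_def bij_betw_def inj_on_def)
  moreover have "|J| \<le>o |{N \<in> J. P - E b \<subseteq> N}|" if "P \<in> J" for P b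
  proof -
    have "|A| \<le>o |E b|"
    proof -
      let ?i = "\<lambda>a. g (if b then Inl a else Inr a)"
      have "inj_on ?i A" "?i ` A \<subseteq> E b"
        using g by (auto simp: E_def bij_betw_def inj_on_def split: if_splits)
      then show ?thesis using card_of_ordLeq by blast
    qed
    then have "|Pow A| \<le>o |Pow (E b)|"
      by (metis card_of_ordLeq image_Pow_mono inj_on_image_Pow)
    moreover have "|Pow (E b)| \<le>o |{N \<in> J. P - E b \<subseteq> N}|"
    proof -
      let ?i = "\<lambda>B. (P - E b) \<union> B"
      have "inj_on ?i (Pow (E b))" by (auto simp: inj_on_def)
      moreover have "?i ` Pow (E b) \<subseteq> {N \<in> J. P - E b \<subseteq> N}"
        using J that A(1) E[of b] by (auto intro!: set_ideal_Un intro: set_ideal_subset)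
      ultimately show ?thesis using card_of_ordLeq by blast
    qed
    ultimately show ?thesis using A(2) ordLeq_transitive by blast
  qed
  ultimately show ?thesis by (rule that)
next
  case False
  have "|J| \<le>o |{N \<in> J. P \<subseteq> N}|" if P: "P \<in> J" for P
  proof (rule ccontr)
    let ?S = "{N \<in> J. P \<subseteq> N}"
    assume "\<not> |J| \<le>o |?S|"
    then have "|?S| <o |J|" using ordLeq_total_card_of by blast
    moreover have "|Pow P| <o |J|" using False P ordLeq_total_card_of by blast
    ultimately have "|?S \<times> Pow P| <o |J|"
      by (rule card_of_Times_ordLess_infinite[OF inf])
    \<comment> \<open>Each \<open>N\<close> is recovered from the superset
      \<open>N \<union> P\<close> of \<open>P\<close> and the trace \<open>N \<inter> P\<close>;
      fewer than \<open>|J|\<close> such pairs cannot produce all of \<open>J\<close>.\<close>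
    moreover have "J \<subseteq> (\<lambda>(N, B). (N - P) \<union> B) ` (?S \<times> Pow P)"
    proof
      fix N assume "N \<in> J"
      then have "N = (\<lambda>(N, B). (N - P) \<union> B) (N \<union> P, N \<inter> P)" "(N \<union> P, N \<inter> P) \<in> ?S \<times> Pow P"
        using J P set_ideal_Un by auto
      then show "N \<in> (\<lambda>(N, B). (N - P) \<union> B) ` (?S \<times> Pow P)" by (rule image_eqI)
    qed
    ultimately show False
      by (meson card_of_image card_of_mono1 not_ordLess_ordLeq ordLeq_transitive)
  qed
  then show ?thesis by (intro that[of "\<lambda>_. {}"]) auto
qed

text \<open>TWO answers a history \<open>h\<close> of ONE's moves with a code \<open>G h\<close>
  that is injective in \<open>h\<close>. The last move of TWO thus reveals all earlier moves of ONE,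
  and the current one is appended. An answer may miss points of one half \<open>E b\<close>, but the
  halves alternate and are disjoint, so every point is caught in some inning.\<close>

lemma winning_coding_strategy_exists:
  assumes J: "set_ideal J" and inf: "infinite J"
    and le: "|countable_unions J| \<le>o |J|"
  shows "\<exists>F. winning_coding_strategy J F"
proof -
  let ?U = "countable_unions J"
  have e: "{} \<in> J" using J by (simp add: set_ideal_def)
  have "\<forall>M\<in>?U. \<exists>p :: nat \<Rightarrow> 'a set. range p \<subseteq> J \<and> M = (\<Union>n. p n)"
    by (auto simp: countable_unions_eq[OF e])
  from bchoice[OF this] obtain p :: "'a set \<Rightarrow> nat \<Rightarrow> 'a set" where
    "\<forall>M\<in>?U. range (p M) \<subseteq> J \<and> M = (\<Union>n. p M n)" ..
  then have p: "range (p M) \<subseteq> J" "M = (\<Union>n. p M n)" if "M \<in> ?U" for M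
    using that by blast+
  \<comment> \<open>After \<open>n\<close> moves of ONE, the first \<open>n\<close> pieces of each
    of them are to be covered. This is a finite union, and every piece of every move enters it
    eventually.\<close>
  define P where "P h = (\<Union>i<length h. \<Union>j<length h. p (h ! i) j)" for h
  have P: "P h \<in> J" if "h \<in> lists ?U" for h
    unfolding P_def
  proof (intro set_ideal_UN[OF J])
    fix i j assume "i \<in> {..<length h}" "j \<in> {..<length h}"
    then have "h ! i \<in> ?U" using that by (simp add: in_lists_conv_set)
    from p(1)[OF this] show "p (h ! i) j \<in> J" by blast
  qed auto
  obtain E :: "bool \<Rightarrow> 'a set" where E: "E True \<inter> E False = {}"
    "\<And>P b. P \<in> J \<Longrightarrow> |J| \<le>o |{N \<in> J. P - E b \<subseteq> N}|"
    using many_supersets_up_to_half[OF J inf] by blast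
  have "J \<subseteq> ?U"
    unfolding countable_unions_def by (auto intro!: exI[of _ "{_}"])
  then have infU: "infinite ?U" using inf finite_subset by blast
  have "|lists ?U| \<le>o |J|"
    using card_of_lists_infinite[OF infU] le ordLeq_transitive by blast
  then have "\<exists>G. inj_on G (lists ?U) \<and>
      (\<forall>h\<in>lists ?U. G h \<in> {N \<in> J. P h - E (even (length h)) \<subseteq> N})"
    using E(2)[OF P] by (intro inj_on_selection) (meson ordLeq_transitive)
  then obtain G where G: "inj_on G (lists ?U)" "\<And>h. h \<in> lists ?U \<Longrightarrow> G h \<in> J"
    "\<And>h. h \<in> lists ?U \<Longrightarrow> P h - E (even (length h)) \<subseteq> G h"
    by blast
  \<comment> \<open>The default \<open>[]\<close> is a legal history, which keeps the values of
    \<open>F\<close> in \<open>J\<close> also at sets \<open>N\<close> that code nothing.\<close>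
  define D where "D N = (if N \<in> G ` lists ?U then inv_into (lists ?U) G N else [])" for N
  have D: "D N \<in> lists ?U" for N
    unfolding D_def using inv_into_into[of N G "lists ?U"] by simp
  have DG: "D (G h) = h" if "h \<in> lists ?U" for h
    unfolding D_def using that G(1) by simp
  define F where "F m = (case m of Inl M \<Rightarrow> G [M] | Inr (N, M) \<Rightarrow> G (D N @ [M]))" for m
  have F: "coding_strategy J F"
    unfolding coding_strategy_def
  proof
    fix m assume "m \<in> coding_domain J"
    then consider M where "m = Inl M" "M \<in> ?U" | N M where "m = Inr (N, M)" "M \<in> ?U"
      unfolding coding_domain_def by blast
    then show "F m \<in> J"
    proof cases
      case (1 M)
      then show ?thesis using G(2)[of "[M]"] by (simp add: F_def)
    next
      case (2 N M)
      then show ?thesis using G(2)[of "D N @ [M]"] D[of N] by (simp add: F_def)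
    qed
  qed
  have "TWO_wins_play M (coding_play F M)" if M: "\<forall>k. M k \<in> ?U" for M
  proof -
    have h: "map M [0..<k] \<in> lists ?U" for k using M by auto
    have play: "coding_play F M k = G (map M [0..<Suc k])" for k
    proof (induction k)
      case (Suc k)
      have "D (G (map M [0..<Suc k])) = map M [0..<Suc k]" by (rule DG[OF h])
      then show ?case using Suc by (simp add: F_def)
    qed (simp add: F_def)
    have "x \<in> (\<Union>k. coding_play F M k)" if x: "x \<in> M i" for x i
    proof -
      obtain j where j: "x \<in> p (M i) j" using p(2)[of "M i"] M x by blast
      have "\<exists>b. x \<notin> E b" using E(1) by blast
      then obtain b where b: "x \<notin> E b" ..
      \<comment> \<open>The history in inning \<open>k\<close> has length \<open>Suc k\<close>, as
        innings count from 0. This length must exceed \<open>i\<close> and \<open>j\<close> and have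
        the parity at which only \<open>E b\<close>, which misses \<open>x\<close>, is left
        out.\<close>
      have "\<exists>k. i < Suc k \<and> j < Suc k \<and> even (Suc k) = b"
        by (intro exI[of _ "if b then 2 * (i + j) + 1 else 2 * (i + j)"]) auto
      then obtain k where k: "i < Suc k" "j < Suc k" "even (Suc k) = b" by blast
      have "x \<in> P (map M [0..<Suc k])"
        unfolding P_def using j k by (auto simp del: upt_Suc)
      then have "x \<in> coding_play F M k"
        using G(3)[OF h[of "Suc k"]] b k(3) play[of k] by (auto simp del: upt_Suc)
      then show ?thesis by blast
    qed
    then show ?thesis unfolding TWO_wins_play_def by blast
  qed
  with F show ?thesis unfolding winning_coding_strategy_def by blast
qed

text \<open>Pigeonhole: \<open>J\<close> has at most \<open>|Z|\<close> members and \<open>H\<close>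
  has more, so after any \<open>N\<close> some answer is given to more than \<open>|Z|\<close> moves
  \<open>M h\<close>. As TWO sees only the last set and the current move, these answers form one
  sequence fixed in advance, and ONE can provoke it by independent choices in each inning.\<close>

lemma no_winning_coding_strategy:
  assumes J: "{} \<in> J" and inf: "infinite Z" and JZ: "|J| \<le>o |Z|" and ZH: "|Z| <o |H|"
    and M: "\<And>h. h \<in> H \<Longrightarrow> M h \<in> countable_unions J"
    and few: "\<And>N. N \<in> countable_unions J \<Longrightarrow> |{h \<in> H. M h \<subseteq> N}| \<le>o |Z|"
  shows "\<not> winning_coding_strategy J F"
proof
  assume F: "winning_coding_strategy J F"
  have fibre: "\<exists>N\<in>J. |Z| <o |{h \<in> H. g h = N}|" if g: "\<And>h. h \<in> H \<Longrightarrow> g h \<in> J" for g :: "_ \<Rightarrow> 'a set"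
  proof (rule ccontr)
    assume "\<not> ?thesis"
    then have "\<forall>N\<in>J. |{h \<in> H. g h = N}| \<le>o |Z|" using ordLeq_total_card_of by blast
    then have "|\<Union>N\<in>J. {h \<in> H. g h = N}| \<le>o |Z|"
      by (rule card_of_UNION_ordLeq_infinite[OF inf JZ])
    moreover have "H \<subseteq> (\<Union>N\<in>J. {h \<in> H. g h = N})" using g by blast
    ultimately have "|H| \<le>o |Z|" using card_of_mono1 ordLeq_transitive by blast
    then show False using ZH not_ordLess_ordLeq by blast
  qed
  have val: "F (Inl (M h)) \<in> J" "N \<in> J \<Longrightarrow> F (Inr (N, M h)) \<in> J" if "h \<in> H" for h N
    using F M[OF that] unfolding winning_coding_strategy_def coding_strategy_def coding_domain_def
    by auto
  obtain N0 where N0: "N0 \<in> J" "|Z| <o |{h \<in> H. F (Inl (M h)) = N0}|"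
    using fibre[of "\<lambda>h. F (Inl (M h))", OF val(1)] by blast
  obtain R where R: "\<And>N. N \<in> J \<Longrightarrow> R N \<in> J \<and> |Z| <o |{h \<in> H. F (Inr (N, M h)) = R N}|"
  proof -
    have "\<forall>N\<in>J. \<exists>N'. N' \<in> J \<and> |Z| <o |{h \<in> H. F (Inr (N, M h)) = N'}|"
    proof
      fix N assume "N \<in> J"
      from fibre[of "\<lambda>h. F (Inr (N, M h))", OF val(2)[OF _ this]]
      show "\<exists>N'. N' \<in> J \<and> |Z| <o |{h \<in> H. F (Inr (N, M h)) = N'}|" by blast
    qed
    from bchoice[OF this] show ?thesis using that by blast
  qed
  define N where "N k = (R ^^ k) N0" for k
  have N: "N k \<in> J" for k
    by (induction k) (use N0 R in \<open>auto simp: N_def\<close>)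
  define D where "D k = {h \<in> H. case k of 0 \<Rightarrow> F (Inl (M h)) = N 0
      | Suc k \<Rightarrow> F (Inr (N k, M h)) = N (Suc k)}" for k
  have D: "|Z| <o |D k|" for k
    using N0(2) R[OF N] by (cases k) (simp_all add: D_def N_def)
  have ne: "\<exists>h. h \<in> D k" for k
  proof (rule ccontr)
    assume "\<nexists>h. h \<in> D k"
    then have "D k = {}" by blast
    then have "|D k| \<le>o |Z|" using card_of_empty by simp
    then show False using D not_ordLess_ordLeq by blast
  qed
  have U: "(\<Union>k. N k) \<in> countable_unions J"
    unfolding countable_unions_eq[OF J] using N by blast
  \<comment> \<open>At most \<open>|Z|\<close> indices give moves inside the fixed union, but more
    than \<open>|Z|\<close> provoke \<open>N 0\<close>; so one of the latter escapes the
    union.\<close>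
  have "\<exists>h\<in>D 0. \<not> M h \<subseteq> (\<Union>k. N k)"
  proof (rule ccontr)
    assume "\<not> ?thesis"
    then have "D 0 \<subseteq> {h \<in> H. M h \<subseteq> (\<Union>k. N k)}" by (auto simp: D_def)
    then have "|D 0| \<le>o |Z|" using few[OF U] card_of_mono1 ordLeq_transitive by blast
    then show False using D not_ordLess_ordLeq by blast
  qed
  then obtain h0 where h0: "h0 \<in> D 0" "\<not> M h0 \<subseteq> (\<Union>k. N k)" by blast
  obtain h1 where h1: "\<And>k. h1 k \<in> D k" using ne by metis
  define h where "h k = (if k = 0 then h0 else h1 k)" for k
  have h: "h k \<in> D k" for k using h0 h1 by (simp add: h_def)
  have play: "coding_play F (M \<circ> h) k = N k" for k
  proof (induction k)
    case 0
    show ?case using h[of 0] by (simp add: D_def)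
  next
    case (Suc k)
    then show ?case using h[of "Suc k"] by (simp add: D_def)
  qed
  have "\<forall>k. (M \<circ> h) k \<in> countable_unions J" using M h by (auto simp: D_def)
  then have "TWO_wins_play (M \<circ> h) (coding_play F (M \<circ> h))"
    using F unfolding winning_coding_strategy_def by blast
  then have "(\<Union>k. (M \<circ> h) k) \<subseteq> (\<Union>k. N k)"
    unfolding TWO_wins_play_def play .
  then have "M (h 0) \<subseteq> (\<Union>k. N k)" by (metis UN_subset_iff UNIV_I comp_apply)
  then show False using h0(2) by (simp add: h_def)
qed

section \<open>Nowhere dense sets\<close>

lemma set_ideal_nowhere_dense_sets: "set_ideal (nowhere_dense_sets X)"
proof -
  \<comment> \<open>An open \<open>T\<close> inside \<open>A \<union> B\<close> leaves the open set
    \<open>T - B\<close> inside \<open>A\<close>, which is therefore empty; so \<open>T\<close> lies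
    in \<open>B\<close> and is empty too.\<close>
  have un: "X interior_of (A \<union> B) = {}"
    if A: "X interior_of A = {}" and B: "closedin X B" "X interior_of B = {}" for A B
  proof -
    have "T = {}" if T: "openin X T" "T \<subseteq> A \<union> B" for T
    proof -
      have "openin X (T - B)" using T(1) B(1) by (rule openin_diff)
      moreover have "T - B \<subseteq> A" using T(2) by blast
      ultimately have "T - B = {}" using interior_of_eq_empty[THEN iffD1, OF A] by blast
      then have "T \<subseteq> B" by blast
      then show "T = {}" using interior_of_eq_empty[THEN iffD1, OF B(2)] T(1) by blast
    qed
    then show ?thesis by (simp add: interior_of_eq_empty)
  qed
  show ?thesis
    unfolding set_ideal_def nowhere_dense_sets_def
  proof (intro conjI ballI allI impI CollectI)
    fix A B assume A: "A \<in> {S. S \<subseteq> topspace X \<and> X interior_of (X closure_of S) = {}}" and "B \<subseteq> A"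
    then show "B \<subseteq> topspace X" by blast
    have "X interior_of (X closure_of B) \<subseteq> X interior_of (X closure_of A)"
      by (intro interior_of_mono closure_of_mono \<open>B \<subseteq> A\<close>)
    then show "X interior_of (X closure_of B) = {}" using A by simp
  next
    fix A B assume AB: "A \<in> {S. S \<subseteq> topspace X \<and> X interior_of (X closure_of S) = {}}"
      "B \<in> {S. S \<subseteq> topspace X \<and> X interior_of (X closure_of S) = {}}"
    then show "A \<union> B \<subseteq> topspace X" by blast
    show "X interior_of (X closure_of (A \<union> B)) = {}"
      unfolding closure_of_Un by (rule un[OF _ closedin_closure_of]) (use AB in auto)
  qed auto
qed

lemma singleton_in_nowhere_dense_sets:
  assumes "t1_space X" "no_isolated_points X" "x \<in> topspace X"
  shows "{x} \<in> nowhere_dense_sets X"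
proof -
  have c: "closedin X {x}" using assms by (simp add: t1_space_closedin_singleton)
  have "T = {}" if "openin X T" "T \<subseteq> {x}" for T
  proof -
    have "T \<noteq> {x}" using that(1) assms(2,3) unfolding no_isolated_points_def by metis
    then show ?thesis using that(2) by (simp add: subset_singleton_iff)
  qed
  then have "X interior_of {x} = {}" by (simp add: interior_of_eq_empty)
  then show ?thesis
    using assms(3) c by (simp add: nowhere_dense_sets_def closure_of_closedin)
qed

text \<open>With the complements of members of \<open>J\<close> and the empty set as open sets, the
  closed sets are \<open>X\<close> and the members of \<open>J\<close>. Hence every subset of
  \<open>X\<close> outside \<open>J\<close> is dense, while a nonempty open set inside a member of
  \<open>J\<close> would make \<open>X\<close> a union of two members.\<close>

lemma topology_of_ideal:
  assumes J: "set_ideal J" and sub: "J \<subseteq> Pow X" and proper: "X \<notin> J"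
    and sing: "\<And>x. x \<in> X \<Longrightarrow> {x} \<in> J"
  shows "\<exists>\<tau>. topspace \<tau> = X \<and> t1_space \<tau> \<and> no_isolated_points \<tau> \<and> nowhere_dense_sets \<tau> = J"
proof -
  let ?O = "\<lambda>U. U = {} \<or> (U \<subseteq> X \<and> X - U \<in> J)"
  have "istopology ?O"
    unfolding istopology_def
  proof (intro conjI allI impI)
    fix S T assume "?O S" "?O T"
    then show "?O (S \<inter> T)"
      using set_ideal_Un[OF J, of "X - S" "X - T"] by (auto simp: Diff_Int)
  next
    fix \<K> assume K: "\<forall>U\<in>\<K>. ?O U"
    show "?O (\<Union>\<K>)"
    proof (cases "\<Union>\<K> = {}")
      case False
      then obtain U where U: "U \<in> \<K>" "U \<noteq> {}" by blast
      then have "X - \<Union>\<K> \<in> J"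
        using K set_ideal_subset[OF J, of "X - U" "X - \<Union>\<K>"] by blast
      moreover have "\<Union>\<K> \<subseteq> X" using K by blast
      ultimately show ?thesis by blast
    qed blast
  qed
  then have op: "openin (topology ?O) U \<longleftrightarrow> ?O U" for U by simp
  define \<tau> where "\<tau> = topology ?O"
  have "{} \<in> J" using J by (simp add: set_ideal_def)
  then have ne: "X \<noteq> {}" using proper by blast
  have top: "topspace \<tau> = X"
  proof
    show "topspace \<tau> \<subseteq> X" using openin_topspace[of \<tau>] unfolding \<tau>_def op by blast
    have "openin \<tau> X" unfolding \<tau>_def op using \<open>{} \<in> J\<close> by simp
    then show "X \<subseteq> topspace \<tau>" by (rule openin_subset)
  qed
  have closed: "closedin \<tau> C \<longleftrightarrow> C \<subseteq> X \<and> (C = X \<or> C \<in> J)" for C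
  proof (cases "C \<subseteq> X")
    case True
    then show ?thesis
      unfolding closedin_def top unfolding \<tau>_def op by (simp add: double_diff) blast
  qed (simp add: closedin_def top)
  have "t1_space \<tau>"
    unfolding t1_space_closedin_singleton closed top using sing by blast
  moreover have "no_isolated_points \<tau>"
    unfolding no_isolated_points_def top
  proof
    fix x assume x: "x \<in> X"
    show "\<not> openin \<tau> {x}"
    proof
      assume "openin \<tau> {x}"
      then have "X - {x} \<in> J" unfolding \<tau>_def op by simp
      from set_ideal_Un[OF J this sing[OF x]] have "X \<in> J" using x by (simp add: insert_absorb)
      then show False using proper by blast
    qed
  qed
  moreover have "nowhere_dense_sets \<tau> = J"
  proof (intro set_eqI iffI)
    fix S assume "S \<in> nowhere_dense_sets \<tau>"
    then have S: "S \<subseteq> X" "\<tau> interior_of (\<tau> closure_of S) = {}"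
      by (auto simp: nowhere_dense_sets_def top)
    have "\<tau> interior_of X = X" using interior_of_topspace[of \<tau>] by (simp add: top)
    then have "\<tau> closure_of S \<noteq> X" using S(2) ne by auto
    then have "\<tau> closure_of S \<in> J" using closed closedin_closure_of by blast
    then show "S \<in> J"
      using set_ideal_subset[OF J] closure_of_subset[of S \<tau>] S(1) top by blast
  next
    fix S assume S: "S \<in> J"
    then have SX: "S \<subseteq> X" using sub by blast
    then have c: "\<tau> closure_of S = S" using S closed closure_of_closedin by blast
    have "T = {}" if T: "openin \<tau> T" "T \<subseteq> S" for T
    proof (rule ccontr)
      assume "T \<noteq> {}"
      then have "X - T \<in> J" using T(1) unfolding \<tau>_def op by blast
      from set_ideal_Un[OF J this set_ideal_subset[OF J S T(2)]] have "X \<in> J"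
        using T(2) SX by (simp add: Un_absorb2)
      then show False using proper by blast
    qed
    then show "S \<in> nowhere_dense_sets \<tau>"
      using SX c by (simp add: nowhere_dense_sets_def top interior_of_eq_empty)
  qed
  ultimately show ?thesis using top by blast
qed

section \<open>Countable powers of cardinals\<close>

lemma ordLess_or_ordLeq_Card_order:
  assumes "Card_order r" "Card_order s"
  shows "r <o s \<or> s \<le>o r"
  using assms by (simp add: card_order_on_def ordLess_or_ordLeq)

text \<open>A witness \<open>a\<close> against cofinality bounds \<open>K\<close> only weakly; an
  infinite cardinal has no largest element, so some \<open>c\<close> above \<open>a\<close> bounds
  it strictly.\<close>

lemma not_cofinal_bounded:
  assumes r: "Card_order r" "infinite (Field r)" and K: "\<not> cofinal K r" "K \<subseteq> Field r"
  shows "\<exists>c\<in>Field r. K \<subseteq> underS r c"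
proof -
  have wo: "wo_rel r" using r(1) by (simp add: card_order_on_def wo_rel_def)
  obtain a where a: "a \<in> Field r" "\<forall>b\<in>K. \<not> (a \<noteq> b \<and> (a, b) \<in> r)"
    using K(1) unfolding cofinal_def by blast
  obtain c where c: "c \<in> Field r" "a \<noteq> c" "(a, c) \<in> r"
    using infinite_Card_order_limit[OF r a(1)] by blast
  have "x \<in> underS r c" if x: "x \<in> K" for x
  proof -
    have "x \<in> Field r" "x = a \<or> (a, x) \<notin> r" using x K(2) a(2) by auto
    then have xa: "(x, a) \<in> r"
      using wo_rel.TOTALS[OF wo] a(1) by auto
    have "(x, c) \<in> r"
      using transD[OF wo_rel.TRANS[OF wo] xa c(3)] .
    moreover have "x \<noteq> c"
      using antisymD[OF wo_rel.ANTISYM[OF wo], of x a] xa c by blast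
    ultimately show ?thesis by (simp add: underS_def)
  qed
  then show ?thesis using c(1) by blast
qed

text \<open>Every sequence has a bounded range, so the sequences form a union of
  \<open>|Field r|\<close> sets, each of size at most \<open>r\<close>.\<close>

lemma card_of_seqs_le:
  assumes r: "Card_order r" "infinite (Field r)"
    and nc: "\<And>f :: nat \<Rightarrow> 'a. range f \<subseteq> Field r \<Longrightarrow> \<not> cofinal (range f) r"
    and le: "\<And>b. b \<in> Field r \<Longrightarrow> |seqs (underS r b)| \<le>o r"
  shows "|seqs (Field r)| \<le>o r"
proof -
  have "seqs (Field r) \<subseteq> (\<Union>b\<in>Field r. seqs (underS r b))"
  proof
    fix f assume "f \<in> seqs (Field r)"
    then have "range f \<subseteq> Field r" by (auto simp: seqs_def)
    from not_cofinal_bounded[OF r nc[OF this] this]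
    show "f \<in> (\<Union>b\<in>Field r. seqs (underS r b))" by (auto simp: seqs_def image_subset_iff)
  qed
  then have "|seqs (Field r)| \<le>o |\<Union>b\<in>Field r. seqs (underS r b)|" by (rule card_of_mono1)
  also have "|\<Union>b\<in>Field r. seqs (underS r b)| \<le>o r"
    using le ordIso_imp_ordLeq[OF card_of_Field_ordIso[OF r(1)]]
    by (intro card_of_UNION_ordLeq_infinite_Field[OF r(2,1)]) auto
  finally show ?thesis .
qed

section \<open>Power sets and countable powers below a strong limit cardinal\<close>

lemma card_of_Pow_mono:
  assumes "|A| \<le>o |B|"
  shows "|Pow A| \<le>o |Pow B|"
proof -
  obtain f where f: "inj_on f A" "f ` A \<subseteq> B"
    using card_of_ordLeq[THEN iffD2, OF assms] by blast
  show ?thesis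
    by (rule card_of_ordLeqI[OF inj_on_image_Pow[OF f(1)]]) (use f(2) in blast)
qed

lemma Pow_ordIso_ctwo_cexp: "|Pow (Field r)| =o ctwo ^c r"
  unfolding ctwo_def cexp_def Field_card_of by (rule card_of_Pow_Func)

lemma strong_limit_Pow:
  fixes \<kappa> :: "'a rel"
  assumes "strong_limit \<kappa>" "|B| <o \<kappa>"
  shows "|Pow B| <o \<kappa>"
proof -
  \<comment> \<open>\<open>strong_limit\<close> speaks of cardinal orders on the type of \<kappa>,
    so \<open>B\<close>, of arbitrary type, is first replaced by a copy inside
    \<open>Field \<kappa>\<close>.\<close>
  obtain C where C: "C \<subset> Field \<kappa>" "|B| =o |C|" "|C| <o \<kappa>"
    using internalize_card_of_ordLess[THEN iffD1, OF assms(2)] by blast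
  have "|Pow B| \<le>o |Pow C|"
    by (rule card_of_Pow_mono[OF ordIso_imp_ordLeq[OF C(2)]])
  also have "|Pow C| =o ctwo ^c |C|"
    using Pow_ordIso_ctwo_cexp[of "|C|"] by (simp add: Field_card_of)
  also have "ctwo ^c |C| <o \<kappa>"
    using assms(1) C(3) card_of_Card_order[of C] unfolding strong_limit_def by blast
  finally show ?thesis .
qed

text \<open>A sequence is determined by its graph.\<close>

lemma card_of_seqs_Pow: "|seqs B| \<le>o |Pow ((UNIV :: nat set) \<times> B)|"
proof (rule card_of_ordLeqI)
  let ?f = "\<lambda>f. {(n, f n) | n. True}"
  show "inj_on ?f (seqs B)"
    by (rule inj_onI, rule ext) (auto simp: set_eq_iff)
qed (auto simp: seqs_def)

lemma card_of_Times_ordLess_Field: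
  assumes "Card_order r" "infinite (Field r)" "|A| <o r" "|B| <o r"
  shows "|A \<times> B| <o r"
proof -
  have iso: "r =o |Field r|" using card_of_Field_ordIso[OF assms(1)] ordIso_symmetric by blast
  have "|A \<times> B| <o |Field r|"
    using assms(2) by (rule card_of_Times_ordLess_infinite)
      (rule ordLess_ordIso_trans[OF assms(3) iso], rule ordLess_ordIso_trans[OF assms(4) iso])
  then show ?thesis using iso ordIso_symmetric ordLess_ordIso_trans by blast
qed

lemma strong_limit_seqs:
  assumes \<kappa>: "Card_order \<kappa>" "strong_limit \<kappa>" "natLeq <o \<kappa>" and B: "|B| <o \<kappa>"
  shows "|seqs B| <o \<kappa>"
proof -
  have inf: "infinite (Field \<kappa>)"
    using \<kappa>(2) by (simp add: strong_limit_def cinfinite_def)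
  have "|UNIV :: nat set| <o \<kappa>"
    using card_of_nat \<kappa>(3) ordIso_ordLess_trans by blast
  then have "|(UNIV :: nat set) \<times> B| <o \<kappa>"
    using card_of_Times_ordLess_Field[OF \<kappa>(1) inf] B by blast
  from strong_limit_Pow[OF \<kappa>(2) this] show ?thesis
    using card_of_seqs_Pow ordLeq_ordLess_trans by blast
qed

lemma cofinality_le_Field:
  assumes "Card_order \<kappa>" "strong_limit \<kappa>"
  shows "cofinality \<kappa> \<le>o \<kappa>"
proof -
  have "Cinfinite \<kappa>" using assms by (simp add: strong_limit_def)
  from cofinality_props(1)[OF this] obtain K where "K \<subseteq> Field \<kappa>" "cofinality \<kappa> = |K|" by blast
  then show ?thesis
    using card_of_mono1[of K "Field \<kappa>"] card_of_Field_ordIso[OF assms(1)] ordLeq_ordIso_trans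
    by metis
qed

lemma countable_not_cofinal:
  assumes "Card_order \<kappa>" "strong_limit \<kappa>" "natLeq <o cofinality \<kappa>"
    and K: "countable K" "K \<subseteq> Field \<kappa>"
  shows "\<not> cofinal K \<kappa>"
proof
  assume "cofinal K \<kappa>"
  moreover have "Cinfinite \<kappa>" using assms by (simp add: strong_limit_def)
  ultimately have "cofinality \<kappa> \<le>o |K|" using cofinality_props(2)[of \<kappa> K] K(2) by blast
  also have "|K| \<le>o |UNIV :: nat set|"
    using K(1) unfolding countable_def by (auto intro: card_of_ordLeqI)
  also have "|UNIV :: nat set| =o natLeq" by (rule card_of_nat)
  finally show False using assms(3) not_ordLess_ordLeq by blast
qed

text \<open>Uncountable cofinality bounds every \<omega>-sequence in \<kappa>, and the strong limit
  property counts the sequences below each bound.\<close>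

lemma card_of_seqs_strong_limit:
  assumes \<kappa>: "Card_order \<kappa>" "strong_limit \<kappa>" "natLeq <o cofinality \<kappa>"
  shows "|seqs (Field \<kappa>)| \<le>o \<kappa>"
proof (rule card_of_seqs_le[OF \<kappa>(1)])
  show "infinite (Field \<kappa>)" using \<kappa>(2) by (simp add: strong_limit_def cinfinite_def)
  show "\<not> cofinal (range f) \<kappa>" if "range f \<subseteq> Field \<kappa>" for f :: "nat \<Rightarrow> _"
    using countable_not_cofinal[OF \<kappa> _ that] by blast
  show "|seqs (underS \<kappa> b)| \<le>o \<kappa>" if "b \<in> Field \<kappa>" for b
    using strong_limit_seqs[OF \<kappa>(1,2) ordLess_ordLeq_trans[OF \<kappa>(3) cofinality_le_Field[OF \<kappa>(1,2)]]
        card_of_underS[OF \<kappa>(1) that]] by (rule ordLess_imp_ordLeq)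
qed

text \<open>Here \<open>r\<close> is the successor of \<open>\<nu>\<close>.\<close>

lemma card_of_seqs_successor:
  fixes r \<nu> :: "'b rel"
  assumes r: "Card_order r" "infinite (Field r)"
    and \<nu>: "Card_order \<nu>" "infinite (Field \<nu>)" "\<nu> <o r" "|seqs (Field \<nu>)| \<le>o \<nu>"
    and max: "\<And>s :: 'b rel. Card_order s \<Longrightarrow> s <o r \<Longrightarrow> s \<le>o \<nu>"
  shows "|seqs (Field r)| \<le>o r"
proof (rule card_of_seqs_le[OF r])
  have le: "|underS r b| \<le>o \<nu>" if "b \<in> Field r" for b
    using max[OF card_of_Card_order card_of_underS[OF r(1) that]] .
  show "\<not> cofinal (range f) r" if f: "range f \<subseteq> Field r" for f :: "nat \<Rightarrow> 'b"
  proof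
    assume "cofinal (range f) r"
    \<comment> \<open>A cofinal sequence would split \<open>r\<close> into countably many initial
      segments of size at most \<nu>, forcing \<open>r \<le>o \<nu>\<close>.\<close>
    then have "Field r \<subseteq> (\<Union>n. underS r (f n))"
      unfolding cofinal_def underS_def by blast
    then have "|Field r| \<le>o |\<Union>n. underS r (f n)|" by (rule card_of_mono1)
    also have "|\<Union>n. underS r (f n)| \<le>o \<nu>"
    proof (rule card_of_UNION_ordLeq_infinite_Field[OF \<nu>(2,1)])
      show "|UNIV :: nat set| \<le>o \<nu>"
        using infinite_iff_card_of_nat[THEN iffD1, OF \<nu>(2)] card_of_Field_ordIso[OF \<nu>(1)]
          ordLeq_ordIso_trans by blast
      show "\<forall>n\<in>UNIV. |underS r (f n)| \<le>o \<nu>" using le f by blast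
    qed
    finally have "|Field r| \<le>o \<nu>" .
    then have "r \<le>o \<nu>"
      using card_of_Field_ordIso[OF r(1)] ordIso_symmetric ordIso_ordLeq_trans by blast
    then show False using \<nu>(3) not_ordLess_ordLeq by blast
  qed
  show "|seqs (underS r b)| \<le>o r" if b: "b \<in> Field r" for b
  proof -
    have "|underS r b| \<le>o |Field \<nu>|"
      using le[OF b] card_of_Field_ordIso[OF \<nu>(1)] ordIso_symmetric ordLeq_ordIso_trans by blast
    then have "|seqs (underS r b)| \<le>o |seqs (Field \<nu>)|" by (rule card_of_seqs_mono)
    also have "|seqs (Field \<nu>)| \<le>o \<nu>" by (rule \<nu>(4))
    also have "\<nu> \<le>o r" using \<nu>(3) by (rule ordLess_imp_ordLeq)
    finally show ?thesis .
  qed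
qed

section \<open>Chains of cardinals\<close>

lemma infinite_quotient_chain:
  fixes c :: "nat \<Rightarrow> 'b rel"
  assumes S: "\<And>n. c n \<in> S" and card: "\<And>s. s \<in> S \<Longrightarrow> Card_order s" and less: "\<And>n. c n <o c (Suc n)"
  shows "infinite (S // ordIso)"
proof -
  have lt: "c m <o c n" if "m < n" for m n
    using that by (induction rule: less_Suc_induct) (use less ordLess_transitive in blast)+
  let ?I = "ordIso :: 'b rel rel"
  have "inj (\<lambda>n. ?I `` {c n})"
  proof (rule linorder_injI)
    fix m n :: nat assume "m < n"
    show "?I `` {c m} \<noteq> ?I `` {c n}"
    proof
      assume eq: "?I `` {c m} = ?I `` {c n}"
      have "c n \<in> ?I `` {c n}"
        using card[OF S] by (simp add: card_order_on_def ordIso_reflexive)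
      then have "c n \<in> ?I `` {c m}" unfolding eq .
      then have "c m =o c n" by simp
      then show False using lt[OF \<open>m < n\<close>] not_ordLess_ordIso by blast
    qed
  qed
  then have "infinite (range (\<lambda>n. ?I `` {c n}))" by (rule range_inj_infinite)
  moreover have "range (\<lambda>n. ?I `` {c n}) \<subseteq> S // ordIso"
    using S by (auto intro: quotientI)
  ultimately show ?thesis using infinite_super by blast
qed

text \<open>Take a least cardinal order, pass to the strictly larger ones, and repeat. Each round
  loses at most one class, so infinitely many remain.\<close>

lemma chain_of_infinite_quotient:
  fixes S :: "'b rel set"
  assumes inf: "infinite (S // ordIso)" and card: "\<And>s. s \<in> S \<Longrightarrow> Card_order s"
  shows "\<exists>c :: nat \<Rightarrow> 'b rel. \<forall>n. c n \<in> S \<and> c n <o c (Suc n)"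
proof -
  define m where "m U = (SOME s. s \<in> U \<and> (\<forall>t\<in>U. s \<le>o t))" for U :: "'b rel set"
  define step where "step U = {t \<in> U. m U <o t}" for U
  define U where "U n = (step ^^ n) S" for n
  have m: "m V \<in> V \<and> (\<forall>t\<in>V. m V \<le>o t)" if V: "V \<subseteq> S" "infinite (V // ordIso)" for V
  proof -
    have "V \<noteq> {}" using V(2) by (auto simp: quotient_empty)
    then have "\<exists>s. s \<in> V \<and> (\<forall>t\<in>V. s \<le>o t)"
      using exists_minim_Card_order[of V] card V(1) by blast
    then show ?thesis unfolding m_def by (rule someI_ex)
  qed
  have U: "U n \<subseteq> S \<and> infinite (U n // ordIso)" for n
  proof (induction n)
    case 0
    then show ?case using inf by (simp add: U_def)
  next
    case (Suc n)
    let ?V = "U n"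
    have eq: "U (Suc n) = {t \<in> ?V. m ?V <o t}" by (simp add: U_def step_def)
    have "?V // ordIso \<subseteq> insert (ordIso `` {m ?V}) (U (Suc n) // ordIso)"
    proof
      fix X assume "X \<in> ?V // ordIso"
      then obtain t where t: "t \<in> ?V" "X = ordIso `` {t}" by (rule quotientE)
      have "m ?V \<le>o t" using m Suc t(1) by blast
      then consider "m ?V <o t" | "m ?V =o t" using ordLeq_iff_ordLess_or_ordIso by blast
      then show "X \<in> insert (ordIso `` {m ?V}) (U (Suc n) // ordIso)"
      proof cases
        case 1
        then show ?thesis using t eq by (auto intro: quotientI)
      next
        case 2
        then have "ordIso `` {m ?V} = ordIso `` {t}"
          using ordIso_symmetric ordIso_transitive by blast
        then show ?thesis using t by blast
      qed
    qed
    then have "infinite (U (Suc n) // ordIso)" using Suc finite_subset by fastforce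
    then show ?case using Suc eq by auto
  qed
  have "m (U n) \<in> S \<and> m (U n) <o m (U (Suc n))" for n
  proof -
    have "m (U (Suc n)) \<in> U (Suc n)" using m U by blast
    then have "m (U n) <o m (U (Suc n))" by (simp add: U_def step_def)
    moreover have "m (U n) \<in> S" using m U by blast
    ultimately show ?thesis by blast
  qed
  then show ?thesis by (intro exI[of _ "\<lambda>n. m (U n)"]) blast
qed

text \<open>Well-founded induction on \<open>r\<close>. If \<open>r\<close> exceeds \<kappa>,
  finiteness yields a largest cardinal \<nu> from \<kappa> on and below \<open>r\<close>; so
  \<open>r\<close> is the successor of \<nu> and inherits the bound on sequences.\<close>

lemma card_of_seqs_finite_between:
  fixes \<kappa> :: "'a rel" and r t :: "'b rel"
  assumes \<kappa>: "Card_order \<kappa>" "infinite (Field \<kappa>)" "|seqs (Field \<kappa>)| \<le>o \<kappa>"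
    and fin: "finite (cardinals_between \<kappa> t)"
    and r: "Card_order r" "\<kappa> \<le>o r" "r \<le>o t"
  shows "|seqs (Field r)| \<le>o r"
  using r
proof (induction r rule: wf_induct_rule[OF wf_ordLess])
  case (1 r)
  have less: "|seqs (Field s)| \<le>o s" if "Card_order s" "\<kappa> \<le>o s" "s <o r" for s :: "'b rel"
    using 1(1)[of s] that 1(4) ordLess_imp_ordLeq ordLess_ordLeq_trans by blast
  show ?case
  proof (cases "r \<le>o \<kappa>")
    case True
    then have "|Field r| \<le>o |Field \<kappa>|" by (rule card_of_mono2)
    then have "|seqs (Field r)| \<le>o |seqs (Field \<kappa>)|" by (rule card_of_seqs_mono)
    also note \<kappa>(3)
    also note 1(3)
    finally show ?thesis .
  next
    case False
    then have lt: "\<kappa> <o r" using ordLess_or_ordLeq_Card_order \<kappa>(1) 1(2) by blast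
    have inf: "infinite (Field s)" if "\<kappa> \<le>o s" for s :: "'b rel"
      using card_of_ordLeq_infinite[OF card_of_mono2[OF that] \<kappa>(2)] .
    let ?T = "{s :: 'b rel. Card_order s \<and> \<kappa> \<le>o s \<and> s <o r}"
    have "\<exists>\<nu>\<in>?T. \<forall>s\<in>?T. s \<le>o \<nu>"
    proof (rule ccontr)
      assume nomax: "\<not> ?thesis"
      have next_T: "\<exists>s. s \<in> ?T \<and> \<nu> <o s" if "\<nu> \<in> ?T" for \<nu>
      proof -
        obtain s where "s \<in> ?T" "\<not> s \<le>o \<nu>" using nomax \<open>\<nu> \<in> ?T\<close> by blast
        then show ?thesis using ordLess_or_ordLeq_Card_order[of \<nu> s] that by blast
      qed
      \<comment> \<open>\<kappa> may live on another type; a subset of \<open>Field r\<close> of the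
        same size represents it.\<close>
      have "\<exists>s. s \<in> ?T"
      proof -
        obtain B where B: "B \<subset> Field r" "|Field \<kappa>| =o |B|" "|B| <o r"
          using internalize_card_of_ordLess[THEN iffD1,
              OF ordIso_ordLess_trans[OF card_of_Field_ordIso[OF \<kappa>(1)] lt]] by blast
        have "\<kappa> =o |B|"
          using card_of_Field_ordIso[OF \<kappa>(1)] B(2) ordIso_symmetric ordIso_transitive by blast
        then show ?thesis using B(3) card_of_Card_order[of B] ordIso_imp_ordLeq by blast
      qed
      then obtain c where c: "\<And>n. c n \<in> ?T \<and> c n <o c (Suc n)"
        using dependent_nat_choice[of "\<lambda>_ s. s \<in> ?T" "\<lambda>_ s s'. s <o s'"] next_T by blast
      have "infinite (cardinals_between \<kappa> t)"
        unfolding cardinals_between_def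
      proof (rule infinite_quotient_chain)
        \<comment> \<open>The shift by one is needed because \<open>c 0\<close> may be a copy of
          \<kappa>, which is not strictly between.\<close>
        show "c (Suc n) \<in> {s. Card_order s \<and> \<kappa> <o s \<and> s <o t}" for n
          using c[of n] c[of "Suc n"] 1(4) ordLeq_ordLess_trans ordLess_ordLeq_trans by blast
        show "c (Suc n) <o c (Suc (Suc n))" for n using c by blast
      qed blast
      then show False using fin by blast
    qed
    then obtain \<nu> where \<nu>: "\<nu> \<in> ?T" "\<And>s. s \<in> ?T \<Longrightarrow> s \<le>o \<nu>" by blast
    show ?thesis
    proof (rule card_of_seqs_successor[OF 1(2) inf[OF 1(3)]])
      show "Card_order \<nu>" "infinite (Field \<nu>)" "\<nu> <o r" "|seqs (Field \<nu>)| \<le>o \<nu>"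
        using \<nu>(1) inf less by blast+
      show "s \<le>o \<nu>" if s: "Card_order s" "s <o r" for s :: "'b rel"
      proof (cases "\<kappa> \<le>o s")
        case True
        then show ?thesis using \<nu>(2) s by blast
      next
        case False
        then have "s <o \<kappa>" using ordLess_or_ordLeq_Card_order \<kappa>(1) s(1) by blast
        then show ?thesis using \<nu>(1) ordLess_ordLeq_trans ordLess_imp_ordLeq by blast
      qed
    qed
  qed
qed

text \<open>Koenig's diagonal argument for families \<open>B n\<close> of subsets of \<kappa> of
  strictly increasing size. Cardinals below \<open>ctwo ^c \<kappa>\<close> can be realised by such
  families.\<close>

lemma koenig_family:
  fixes \<kappa> :: "'a rel"
  assumes \<kappa>: "Card_order \<kappa>" and inf: "infinite (cardinals_between \<kappa> (ctwo ^c \<kappa> :: ('a \<Rightarrow> bool) rel))"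
  shows "\<exists>\<S> \<subseteq> Pow (Field \<kappa>). \<kappa> \<le>o |\<S>| \<and> |\<S>| <o |seqs \<S>|"
proof -
  let ?R = "{s :: ('a \<Rightarrow> bool) rel. Card_order s \<and> \<kappa> <o s \<and> s <o ctwo ^c \<kappa>}"
  have "\<exists>c :: nat \<Rightarrow> ('a \<Rightarrow> bool) rel. \<forall>n. c n \<in> ?R \<and> c n <o c (Suc n)"
    using inf unfolding cardinals_between_def by (rule chain_of_infinite_quotient) blast
  then obtain c :: "nat \<Rightarrow> ('a \<Rightarrow> bool) rel" where c: "\<And>n. c n \<in> ?R" "\<And>n. c n <o c (Suc n)" by blast
  have "\<exists>B. B \<subseteq> Pow (Field \<kappa>) \<and> |B| =o c n" for n
  proof -
    have iso: "|Field (c n)| =o c n" using c(1) card_of_Field_ordIso by blast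
    have "|Field (c n)| \<le>o |Pow (Field \<kappa>)|"
      using iso c(1)[of n] Pow_ordIso_ctwo_cexp[of \<kappa>] ordIso_symmetric ordLess_imp_ordLeq
        ordIso_ordLeq_trans ordLeq_ordIso_trans by blast
    from internalize_card_of_ordLeq2[THEN iffD1, OF this]
    obtain B where B: "B \<subseteq> Pow (Field \<kappa>)" "|Field (c n)| =o |B|" by blast
    then show ?thesis using ordIso_transitive[OF ordIso_symmetric[OF B(2)] iso] by blast
  qed
  then obtain B where B: "\<And>n. B n \<subseteq> Pow (Field \<kappa>)" "\<And>n. |B n| =o c n" by metis
  let ?S = "\<Union>n. B n"
  have lt: "|B n| <o |B (Suc n)|" for n
    using B(2) c(2) ordIso_symmetric ordIso_ordLess_trans ordLess_ordIso_trans by blast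
  have "\<kappa> \<le>o |?S|"
  proof -
    have "\<kappa> \<le>o c 0" using c(1) ordLess_imp_ordLeq by blast
    also have "c 0 =o |B 0|" using B(2) by (rule ordIso_symmetric)
    also have "|B 0| \<le>o |?S|" by (intro card_of_mono1) blast
    finally show ?thesis .
  qed
  moreover have "|?S| <o |seqs ?S|"
  proof (rule ccontr)
    assume "\<not> ?thesis"
    then have le: "|seqs ?S| \<le>o |?S|" using ordLeq_total_card_of by blast
    have diag: "\<exists>y. y \<in> B (Suc n) \<and> y \<notin> (\<lambda>x. g x n) ` B n" for g :: "'a set \<Rightarrow> nat \<Rightarrow> 'a set" and n
    proof (rule ccontr)
      assume "\<not> ?thesis"
      then have "B (Suc n) \<subseteq> (\<lambda>x. g x n) ` B n" by blast
      then have "|B (Suc n)| \<le>o |B n|"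
        by (rule ordLeq_transitive[OF card_of_mono1 card_of_image])
      then show False using lt not_ordLess_ordLeq by blast
    qed
    have "seqs ?S \<noteq> {}"
    proof -
      from diag[where n = 0 and g = "\<lambda>_ _. {}"] obtain y where "y \<in> B (Suc 0)" by blast
      then have "y \<in> ?S" by blast
      then have "(\<lambda>_. y) \<in> seqs ?S" by (simp add: seqs_def)
      then show ?thesis by blast
    qed
    from card_of_ordLeq2[THEN iffD2, OF this le] obtain g where g: "g ` ?S = seqs ?S" ..
    have "\<forall>n. \<exists>y. y \<in> B (Suc n) \<and> y \<notin> (\<lambda>x. g x n) ` B n" using diag[where g = g] by blast
    \<comment> \<open>Entry \<open>n\<close> of the diagonal sequence differs from entry
      \<open>n\<close> of \<open>g x\<close> for all \<open>x\<close> in \<open>B n\<close>, so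
      \<open>h\<close> is no value of \<open>g\<close>.\<close>
    from choice[OF this] obtain h where
      h: "\<And>n. h n \<in> B (Suc n)" "\<And>n. h n \<notin> (\<lambda>x. g x n) ` B n" by blast
    then have "h \<in> seqs ?S" by (auto simp: seqs_def)
    then obtain x where "x \<in> ?S" "h = g x" using g by blast
    then show False using h(2) by blast
  qed
  moreover have "?S \<subseteq> Pow (Field \<kappa>)" using B(1) by blast
  ultimately show ?thesis by blast
qed

section \<open>The ideal generated by a family of branches\<close>

text \<open>Two properties of the branches matter: each has fewer than \<kappa> points, which keeps
  \<open>J\<close> no larger than \<S>, and none is covered by countably many others together with a
  countable set, which limits the moves of ONE inside any countable union from
  \<open>J\<close>.\<close>

lemma ideal_without_winning_coding_strategy:
  fixes \<kappa> :: "'a rel"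
  assumes \<kappa>: "Card_order \<kappa>" "singularCard \<kappa>" "strong_limit \<kappa>" "natLeq <o cofinality \<kappa>"
    and \<S>: "\<S> \<subseteq> Pow (Field \<kappa>)" "\<kappa> \<le>o |\<S>|" "|\<S>| <o |seqs \<S>|"
  shows "\<exists>J. set_ideal J \<and> J \<subseteq> Pow (Field \<kappa>) \<and> Field \<kappa> \<notin> J \<and> (\<forall>x\<in>Field \<kappa>. {x} \<in> J) \<and>
    (\<forall>F. \<not> winning_coding_strategy J F)"
proof -
  let ?X = "Field \<kappa>"
  have cinf: "Cinfinite \<kappa>" using \<kappa>(3) by (simp add: strong_limit_def)
  have inf: "infinite ?X" using cinf by (simp add: cinfinite_def)
  have wo: "wo_rel \<kappa>" using \<kappa>(1) by (simp add: card_order_on_def wo_rel_def)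
  have nat\<kappa>: "natLeq <o \<kappa>"
    using ordLess_ordLeq_trans[OF \<kappa>(4) cofinality_le_Field[OF \<kappa>(1,3)]] .
  have small_finite: "|D| <o \<kappa>" if "finite D" for D :: "'c set"
    using ordLess_transitive[OF finite_iff_ordLess_natLeq[THEN iffD1, OF that] nat\<kappa>] .
  have small_countable: "|D| <o \<kappa>" if "countable D" for D :: "'c set"
  proof -
    have "|D| \<le>o |UNIV :: nat set|"
      using that unfolding countable_def by (auto intro: card_of_ordLeqI)
    then show ?thesis using nat\<kappa> card_of_nat ordLeq_ordIso_trans ordLeq_ordLess_trans by blast
  qed
  have le_\<S>: "|D| \<le>o |\<S>|" if "|D| <o \<kappa>" for D :: "'c set"
    using ordLeq_transitive[OF ordLess_imp_ordLeq[OF that] \<S>(2)] .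
  have X_le: "|?X| \<le>o |\<S>|"
    using ordIso_ordLeq_trans[OF card_of_Field_ordIso[OF \<kappa>(1)] \<S>(2)] .
  have inf_\<S>: "infinite \<S>" using card_of_ordLeq_infinite[OF X_le inf] .
  \<comment> \<open>Singularity enters here: with levels only from \<open>K\<close>, every branch
    has fewer than \<kappa> points.\<close>
  obtain K where K: "K \<subseteq> ?X" "cofinal K \<kappa>" "|K| <o \<kappa>"
  proof -
    obtain K where K: "K \<subseteq> ?X" "cofinal K \<kappa>" "\<not> |K| =o \<kappa>"
      using \<kappa>(2) unfolding singularCard_def regularCard_def by blast
    have "|K| \<le>o \<kappa>"
      using ordLeq_ordIso_trans[OF card_of_mono1[OF K(1)] card_of_Field_ordIso[OF \<kappa>(1)]] .
    then show ?thesis using that[of K] K ordLeq_iff_ordLess_or_ordIso by blast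
  qed
  \<comment> \<open>The nodes of the tree of traces: fewer than \<kappa> on each level, since
    \<kappa> is a strong limit, so \<open>e\<close> can code them by points of \<kappa>.\<close>
  let ?T = "SIGMA \<alpha>:K. Pow (underS \<kappa> \<alpha>)"
  have "|?T| \<le>o |?X|"
  proof (rule card_of_Sigma_ordLeq_infinite[OF inf])
    show "|K| \<le>o |?X|" using K(1) by (rule card_of_mono1)
    show "\<forall>\<alpha>\<in>K. |Pow (underS \<kappa> \<alpha>)| \<le>o |?X|"
    proof
      fix \<alpha> assume "\<alpha> \<in> K"
      then have "\<alpha> \<in> ?X" using K(1) by blast
      have "|Pow (underS \<kappa> \<alpha>)| <o \<kappa>"
        by (rule strong_limit_Pow[OF \<kappa>(3) card_of_underS[OF \<kappa>(1) \<open>\<alpha> \<in> ?X\<close>]])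
      then show "|Pow (underS \<kappa> \<alpha>)| \<le>o |?X|"
        using ordLeq_ordIso_trans[OF ordLess_imp_ordLeq ordIso_symmetric[OF card_of_Field_ordIso[OF \<kappa>(1)]]]
        by blast
    qed
  qed
  from card_of_ordLeq[THEN iffD2, OF this] obtain e where e: "inj_on e ?T" "e ` ?T \<subseteq> ?X" by blast
  define A where "A S = (\<lambda>\<alpha>. e (\<alpha>, S \<inter> underS \<kappa> \<alpha>)) ` K" for S
  have inT: "(\<alpha>, S \<inter> underS \<kappa> \<alpha>) \<in> ?T" if "\<alpha> \<in> K" for \<alpha> S using that by blast
  have A_sub: "A S \<subseteq> ?X" for S
    unfolding A_def using inT e(2) by blast
  have A_small: "|A S| <o \<kappa>" for S
    unfolding A_def by (rule ordLeq_ordLess_trans[OF card_of_image K(3)])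

  \<comment> \<open>Countable sets are bounded, so some level \<alpha> in \<open>K\<close> lies
    above a point where \<open>S\<close> differs from each member of \<open>C\<close> and above the
    levels of all nodes in \<open>D\<close>. The node of \<open>A S\<close> at level \<alpha> is
    then not covered.\<close>
  have A_not_covered: "\<not> A S \<subseteq> (\<Union>S'\<in>C. A S') \<union> D"
    if C: "countable C" "C \<subseteq> Pow ?X" and D: "countable D" and S: "S \<subseteq> ?X" "S \<notin> C" for C D S
  proof
    assume cov: "A S \<subseteq> (\<Union>S'\<in>C. A S') \<union> D"
    have "\<forall>S'\<in>C. \<exists>x. x \<in> ?X \<and> (x \<in> S) \<noteq> (x \<in> S')"
    proof
      fix S' assume "S' \<in> C"
      then have "S' \<noteq> S" "S' \<subseteq> ?X" using C S by blast+
      then show "\<exists>x. x \<in> ?X \<and> (x \<in> S) \<noteq> (x \<in> S')" using S(1) by blast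
    qed
    from bchoice[OF this] obtain x where
      x: "\<And>S'. S' \<in> C \<Longrightarrow> x S' \<in> ?X \<and> (x S' \<in> S) \<noteq> (x S' \<in> S')" by blast
    define y where "y d = fst (inv_into ?T e d)" for d
    \<comment> \<open>\<open>y d\<close> is the level of the node coded by \<open>d\<close>, but
      arbitrary if \<open>d\<close> codes none; hence the intersection with the field.\<close>
    let ?B = "x ` C \<union> (y ` D \<inter> ?X)"
    have "countable ?B" using C(1) D by simp
    moreover have B: "?B \<subseteq> ?X" using x by blast
    ultimately have "\<not> cofinal ?B \<kappa>" by (rule countable_not_cofinal[OF \<kappa>(1,3,4)])
    from not_cofinal_bounded[OF \<kappa>(1) inf this B] obtain c where c: "c \<in> ?X" "?B \<subseteq> underS \<kappa> c" ..
    obtain \<alpha> where \<alpha>: "\<alpha> \<in> K" "c \<noteq> \<alpha>" "(c, \<alpha>) \<in> \<kappa>" using K(2) c(1) unfolding cofinal_def by blast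
    have B\<alpha>: "b \<in> underS \<kappa> \<alpha>" if "b \<in> ?B" for b
    proof -
      have b: "(b, c) \<in> \<kappa>" "b \<noteq> c" using c(2) that by (auto simp: underS_def)
      have "(b, \<alpha>) \<in> \<kappa>" using transD[OF wo_rel.TRANS[OF wo] b(1) \<alpha>(3)] .
      moreover have "b \<noteq> \<alpha>" using antisymD[OF wo_rel.ANTISYM[OF wo], of b c] b \<alpha>(3) by blast
      ultimately show ?thesis by (simp add: underS_def)
    qed
    let ?p = "e (\<alpha>, S \<inter> underS \<kappa> \<alpha>)"
    have "?p \<in> A S" unfolding A_def using \<alpha>(1) by blast
    then consider S' where "S' \<in> C" "?p \<in> A S'" | "?p \<in> D" using cov by blast
    then show False
    proof cases
      case (1 S')
      then obtain \<beta> where \<beta>: "\<beta> \<in> K" "?p = e (\<beta>, S' \<inter> underS \<kappa> \<beta>)" unfolding A_def by blast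
      have "(\<alpha>, S \<inter> underS \<kappa> \<alpha>) = (\<beta>, S' \<inter> underS \<kappa> \<beta>)"
        by (rule inj_onD[OF e(1) \<beta>(2) inT[OF \<alpha>(1)] inT[OF \<beta>(1)]])
      then have "S \<inter> underS \<kappa> \<alpha> = S' \<inter> underS \<kappa> \<alpha>" by (metis Pair_inject)
      moreover have "x S' \<in> underS \<kappa> \<alpha>" using B\<alpha> 1(1) by blast
      ultimately show False using x[OF 1(1)] by blast
    next
      case 2
      have y: "y ?p = \<alpha>" unfolding y_def by (simp add: inv_into_f_f[OF e(1) inT[OF \<alpha>(1)]])
      have "y ?p \<in> y ` D" using 2 by (rule imageI)
      then have "\<alpha> \<in> ?B" using \<alpha>(1) K(1) unfolding y by blast
      then show False using B\<alpha>[of \<alpha>] by (simp add: underS_def)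
    qed
  qed

  \<comment> \<open>The ideal generated by branches and points, and its size\<close>
  define J where "J = {N. N \<subseteq> ?X \<and> (\<exists>C\<in>Fpow \<S>. \<exists>D\<in>Fpow ?X. N \<subseteq> (\<Union>S\<in>C. A S) \<union> D)}"
  have JI: "N \<in> J" if "N \<subseteq> ?X" "C \<subseteq> \<S>" "finite C" "D \<subseteq> ?X" "finite D" "N \<subseteq> (\<Union>S\<in>C. A S) \<union> D" for N C D
    using that unfolding J_def Fpow_def by blast
  have JE: "\<exists>C D. C \<subseteq> \<S> \<and> finite C \<and> D \<subseteq> ?X \<and> finite D \<and> N \<subseteq> (\<Union>S\<in>C. A S) \<union> D" if "N \<in> J" for N
    using that unfolding J_def Fpow_def by blast
  have J_sub: "J \<subseteq> Pow ?X" unfolding J_def by blast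
  have empty_J: "{} \<in> J" by (rule JI[of _ "{}" "{}"]) auto
  have ideal: "set_ideal J"
    unfolding set_ideal_def
  proof (intro conjI ballI allI impI)
    show "{} \<in> J" by (rule empty_J)
    fix N assume N: "N \<in> J"
    from JE[OF this] obtain C D where
      CD: "C \<subseteq> \<S>" "finite C" "D \<subseteq> ?X" "finite D" "N \<subseteq> (\<Union>S\<in>C. A S) \<union> D"
      by blast
    show "N' \<in> J" if N': "N' \<subseteq> N" for N'
    proof (rule JI[OF _ CD(1-4)])
      show "N' \<subseteq> ?X" using N J_sub N' by blast
      show "N' \<subseteq> (\<Union>S\<in>C. A S) \<union> D" using N' CD(5) by (rule subset_trans)
    qed
    fix N' assume N': "N' \<in> J"
    from JE[OF this] obtain C' D' where CD': "C' \<subseteq> \<S>" "finite C'" "D' \<subseteq> ?X" "finite D'"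
      "N' \<subseteq> (\<Union>S\<in>C'. A S) \<union> D'"
      by blast
    show "N \<union> N' \<in> J"
    proof (rule JI[of _ "C \<union> C'" "D \<union> D'"])
      show "N \<union> N' \<subseteq> ?X" using N N' J_sub by blast
      show "N \<union> N' \<subseteq> (\<Union>S\<in>C \<union> C'. A S) \<union> (D \<union> D')" using CD(5) CD'(5) by blast
    qed (use CD CD' in auto)
  qed
  have sing: "{x} \<in> J" if "x \<in> ?X" for x
    by (rule JI[of _ "{}" "{x}"]) (use that in auto)
  have A_J: "A S \<in> J" if "S \<in> \<S>" for S
    by (rule JI[of _ "{S}" "{}"]) (use that A_sub in auto)
  have proper: "?X \<notin> J"
  proof
    assume "?X \<in> J"
    from JE[OF this] obtain C D where
      CD: "C \<subseteq> \<S>" "finite C" "finite D" "?X \<subseteq> (\<Union>S\<in>C. A S) \<union> D"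
      by blast
    have "\<not> \<S> \<subseteq> C" using inf_\<S> finite_subset[OF _ CD(2)] by metis
    then obtain S where S: "S \<in> \<S>" "S \<notin> C" by blast
    have "\<not> A S \<subseteq> (\<Union>S'\<in>C. A S') \<union> D"
      using CD(1-3) S \<S>(1) by (intro A_not_covered) (auto intro: countable_finite)
    then show False using A_sub CD(4) by blast
  qed
  \<comment> \<open>A finite union of branches and points has fewer than \<kappa> points, hence
    fewer than \<kappa> subsets, and there are at most \<open>|\<S>|\<close> such unions.\<close>
  have J_le: "|J| \<le>o |\<S>|"
  proof -
    have "J \<subseteq> (\<Union>C\<in>Fpow \<S>. \<Union>D\<in>Fpow ?X. Pow ((\<Union>S\<in>C. A S) \<union> D))"
      unfolding J_def by blast
    then have "|J| \<le>o |\<Union>C\<in>Fpow \<S>. \<Union>D\<in>Fpow ?X. Pow ((\<Union>S\<in>C. A S) \<union> D)|"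
      by (rule card_of_mono1)
    also have "|\<Union>C\<in>Fpow \<S>. \<Union>D\<in>Fpow ?X. Pow ((\<Union>S\<in>C. A S) \<union> D)| \<le>o |\<S>|"
    proof (intro card_of_UNION_ordLeq_infinite[OF inf_\<S>] ballI)
      show "|Fpow \<S>| \<le>o |\<S>|" by (rule card_of_Fpow_infinite[OF inf_\<S>])
      show "|Fpow ?X| \<le>o |\<S>|"
        by (rule ordLeq_transitive[OF card_of_Fpow_infinite[OF inf] X_le])
      fix C D assume "C \<in> Fpow \<S>" "D \<in> Fpow ?X"
      then have fin: "finite C" "finite D" by (simp_all add: Fpow_def)
      have un: "|B \<union> B'| <o \<kappa>" if "|B| <o \<kappa>" "|B'| <o \<kappa>" for B B' :: "'a set"
        by (rule card_of_Un_ordLess_infinite_Field[OF inf \<kappa>(1) that])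
      have "|\<Union>S\<in>C. A S| <o \<kappa>"
        using fin(1)
      proof (induction C)
        case empty
        then show ?case using small_finite[of "{} :: 'a set"] by simp
      next
        case (insert S C)
        then show ?case using un[OF A_small] by simp
      qed
      then have "|(\<Union>S\<in>C. A S) \<union> D| <o \<kappa>" using un small_finite[OF fin(2)] by blast
      then show "|Pow ((\<Union>S\<in>C. A S) \<union> D)| \<le>o |\<S>|"
        by (rule le_\<S>[OF strong_limit_Pow[OF \<kappa>(3)]])
    qed
    finally show ?thesis .
  qed
  \<comment> \<open>Different \<open>h\<close> may give the same move of ONE, but both cardinality
    bounds count the indices \<open>h\<close>.\<close>
  define M where "M h = (\<Union>n::nat. A (h n))" for h
  have "\<not> winning_coding_strategy J F" for F
  proof (rule no_winning_coding_strategy[OF empty_J inf_\<S> J_le \<S>(3)])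
    show "M h \<in> countable_unions J" if "h \<in> seqs \<S>" for h
    proof -
      have "range (\<lambda>n. A (h n)) \<subseteq> J" using that A_J by (auto simp: seqs_def)
      then show ?thesis unfolding countable_unions_eq[OF empty_J] M_def by blast
    qed
    show "|{h \<in> seqs \<S>. M h \<subseteq> N}| \<le>o |\<S>|" if N: "N \<in> countable_unions J" for N
    proof -
      obtain p :: "nat \<Rightarrow> 'a set" where p: "range p \<subseteq> J" "N = (\<Union>n. p n)"
        using N unfolding countable_unions_eq[OF empty_J] by blast
      have "\<forall>n. \<exists>CD. fst CD \<subseteq> \<S> \<and> finite (fst CD) \<and> finite (snd CD) \<and>
          p n \<subseteq> (\<Union>S\<in>fst CD. A S) \<union> snd CD"
      proof
        fix n
        have "p n \<in> J" using p(1) by blast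
        from JE[OF this] obtain C D where
          "C \<subseteq> \<S>" "finite C" "finite D" "p n \<subseteq> (\<Union>S\<in>C. A S) \<union> D" by blast
        then show "\<exists>CD. fst CD \<subseteq> \<S> \<and> finite (fst CD) \<and> finite (snd CD) \<and>
          p n \<subseteq> (\<Union>S\<in>fst CD. A S) \<union> snd CD"
          by (intro exI[of _ "(C, D)"]) simp
      qed
      from choice[OF this] obtain CD where CD: "\<And>n. fst (CD n) \<subseteq> \<S>" "\<And>n. finite (fst (CD n))"
        "\<And>n. finite (snd (CD n))" "\<And>n. p n \<subseteq> (\<Union>S\<in>fst (CD n). A S) \<union> snd (CD n)"
        by blast
      let ?C = "\<Union>n. fst (CD n)" and ?D = "\<Union>n. snd (CD n)"
      have cnt: "countable ?C" "countable ?D"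
        using CD(2,3) by (auto intro: countable_finite)
      have "N \<subseteq> (\<Union>S\<in>?C. A S) \<union> ?D"
      proof
        fix x assume "x \<in> N"
        then obtain n where "x \<in> p n" unfolding p(2) by blast
        then have "x \<in> (\<Union>S\<in>fst (CD n). A S) \<union> snd (CD n)" using CD(4)[of n] by (rule rev_subsetD)
        then show "x \<in> (\<Union>S\<in>?C. A S) \<union> ?D" by blast
      qed
      then have cov: "A (h n) \<subseteq> (\<Union>S\<in>?C. A S) \<union> ?D" if "M h \<subseteq> N" for h n
      proof -
        have "A (h n) \<subseteq> M h" unfolding M_def by blast
        also note that
        also note \<open>N \<subseteq> (\<Union>S\<in>?C. A S) \<union> ?D\<close>
        finally show ?thesis .
      qed
      \<comment> \<open>A branch inside \<open>N\<close> must be one of the countably many used to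
        cover \<open>N\<close>, so all entries of \<open>h\<close> come from
        \<open>?C\<close>.\<close>
      have "{h \<in> seqs \<S>. M h \<subseteq> N} \<subseteq> seqs ?C"
      proof
        fix h assume h: "h \<in> {h \<in> seqs \<S>. M h \<subseteq> N}"
        have "h n \<in> ?C" for n
        proof (rule ccontr)
          assume "h n \<notin> ?C"
          moreover have "h n \<subseteq> ?X" using h \<S>(1) by (auto simp: seqs_def)
          moreover have "?C \<subseteq> Pow ?X" using CD(1) \<S>(1) by blast
          ultimately have "\<not> A (h n) \<subseteq> (\<Union>S\<in>?C. A S) \<union> ?D"
            by (intro A_not_covered[OF cnt(1) _ cnt(2)])
          then show False using cov h by blast
        qed
        then show "h \<in> seqs ?C" by (simp add: seqs_def)
      qed
      then have "|{h \<in> seqs \<S>. M h \<subseteq> N}| \<le>o |seqs ?C|" by (rule card_of_mono1)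
      also have "|seqs ?C| \<le>o |\<S>|"
        by (rule le_\<S>[OF strong_limit_seqs[OF \<kappa>(1,3) nat\<kappa> small_countable[OF cnt(1)]]])
      finally show ?thesis .
    qed
  qed
  then show ?thesis using ideal J_sub proper sing by blast
qed

section \<open>The two directions of the equivalence\<close>

theorem theorem1:
  fixes \<kappa> :: "'a rel"
  assumes "Card_order \<kappa>"
    and "singularCard \<kappa>"
    and "strong_limit \<kappa>"
    and "natLeq <o cofinality \<kappa>"
  shows "(\<exists>\<tau> :: 'a topology. topspace \<tau> = Field \<kappa> \<and> t1_space \<tau> \<and> no_isolated_points \<tau> \<and>
            \<not> (\<exists>F. winning_coding_strategy (nowhere_dense_sets \<tau>) F))
         \<longleftrightarrow> infinite (cardinals_between \<kappa> (ctwo ^c \<kappa>))"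
proof
  assume "\<exists>\<tau> :: 'a topology. topspace \<tau> = Field \<kappa> \<and> t1_space \<tau> \<and> no_isolated_points \<tau> \<and>
            \<not> (\<exists>F. winning_coding_strategy (nowhere_dense_sets \<tau>) F)"
  then obtain \<tau> :: "'a topology" where \<tau>: "topspace \<tau> = Field \<kappa>" "t1_space \<tau>" "no_isolated_points \<tau>"
    and no: "\<not> (\<exists>F. winning_coding_strategy (nowhere_dense_sets \<tau>) F)" by blast
  let ?J = "nowhere_dense_sets \<tau>"
  show "infinite (cardinals_between \<kappa> (ctwo ^c \<kappa>))"
  proof
    assume fin: "finite (cardinals_between \<kappa> (ctwo ^c \<kappa>))"
    have inf: "infinite (Field \<kappa>)" using assms(3) by (simp add: strong_limit_def cinfinite_def)
    have sing: "|Field \<kappa>| \<le>o |?J|"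
      by (rule card_of_ordLeqI[of "\<lambda>x. {x}"])
        (auto intro: singleton_in_nowhere_dense_sets simp: \<tau>)
    have J_inf: "infinite ?J" using card_of_ordLeq_infinite[OF sing inf] .
    \<comment> \<open>\<open>ctwo ^c \<kappa>\<close> is an order on predicates, so
      \<open>?J\<close> is replaced by the equinumerous family of membership predicates, to fit the
      type in \<open>cardinals_between\<close>.\<close>
    define J' where "J' = (\<lambda>N x. x \<in> N) ` ?J"
    have iso: "|?J| =o |J'|"
      unfolding J'_def
      by (rule card_of_ordIsoI[of "\<lambda>N x. x \<in> N"], rule inj_on_imp_bij_betw)
        (auto simp: inj_on_def fun_eq_iff)
    have "|seqs (Field |J'| )| \<le>o |J'|"
    proof (rule card_of_seqs_finite_between[OF assms(1) inf _ fin card_of_Card_order])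
      show "|seqs (Field \<kappa>)| \<le>o \<kappa>" by (rule card_of_seqs_strong_limit[OF assms(1,3,4)])
      show "\<kappa> \<le>o |J'|"
        using ordIso_ordLeq_trans[OF ordIso_symmetric[OF card_of_Field_ordIso[OF assms(1)]]
            ordLeq_ordIso_trans[OF sing iso]] .
      have "|?J| \<le>o |Pow (Field \<kappa>)|"
        by (rule card_of_mono1) (auto simp: nowhere_dense_sets_def \<tau>)
      then show "|J'| \<le>o ctwo ^c \<kappa>"
        using ordIso_ordLeq_trans[OF ordIso_symmetric[OF iso]
            ordLeq_ordIso_trans[OF _ Pow_ordIso_ctwo_cexp]] by blast
    qed
    then have J': "|seqs J'| \<le>o |J'|" by (simp add: Field_card_of)
    have ideal: "set_ideal ?J" by (rule set_ideal_nowhere_dense_sets)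
    have "|countable_unions ?J| \<le>o |seqs ?J|"
      by (rule card_of_countable_unions) (use ideal in \<open>simp add: set_ideal_def\<close>)
    also have "|seqs ?J| \<le>o |seqs J'|"
      by (rule card_of_seqs_mono[OF ordIso_imp_ordLeq[OF iso]])
    also note J'
    also have "|J'| =o |?J|" by (rule ordIso_symmetric[OF iso])
    finally show False using winning_coding_strategy_exists[OF ideal J_inf] no by blast
  qed
next
  assume "infinite (cardinals_between \<kappa> (ctwo ^c \<kappa>))"
  from koenig_family[OF assms(1) this] obtain \<S> where
    \<S>: "\<S> \<subseteq> Pow (Field \<kappa>)" "\<kappa> \<le>o |\<S>|" "|\<S>| <o |seqs \<S>|" by blast
  from ideal_without_winning_coding_strategy[OF assms \<S>] obtain J where
    J: "set_ideal J" "J \<subseteq> Pow (Field \<kappa>)" "Field \<kappa> \<notin> J" "\<And>x. x \<in> Field \<kappa> \<Longrightarrow> {x} \<in> J"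
    and no: "\<And>F. \<not> winning_coding_strategy J F" by blast
  from topology_of_ideal[OF J] obtain \<tau> where
    "topspace \<tau> = Field \<kappa>" "t1_space \<tau>" "no_isolated_points \<tau>" "nowhere_dense_sets \<tau> = J" by blast
  then show "\<exists>\<tau> :: 'a topology. topspace \<tau> = Field \<kappa> \<and> t1_space \<tau> \<and> no_isolated_points \<tau> \<and>
            \<not> (\<exists>F. winning_coding_strategy (nowhere_dense_sets \<tau>) F)"
    using no by blast
qed

end
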